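(* Let $n$ be a natural number and let $\mu$ be an $\mathrm{Out}(F_n)$-invariant, ergodic probability measure on $\mathcal G_n$. For any countable set $F$ of sentences in $\mathcal L_{\omega_1,\omega}$, there exists a Borel subset $A_F\subseteq \mathcal G_n$ of measure $\mu(A_F)=1$ such that, for any $(G,X),(H,Y)\in A_F$, we have $G\equiv_F H$. In particular, there exists a Borel subset $A\subseteq \mathcal G_n$ such that $\mu(A)=1$ and, for any $(G,X),(H,Y)\in A$, the groups $G$ and $H$ are elementarily equivalent.
   Context: $F_n$ denotes the free group of rank $n$. An $n$-generated marked group is a pair $(G,X)$ where $G$ is a group and $X=(x_1,\dots,x_n)\in G^n$ is an ordered generating set; $(G,(x_1,\dots,x_n))$ and $(H,(y_1,\dots,y_n))$ are isomorphic as marked groups if there is a group isomorphism $G\to H$ sending $x_i$ to $y_i$ for all $i$. The space $\mathcal G_n$ of isomorphism classes of $n$-generated marked groups is identified with the set of normal subgroups of $F_n$: $(G,X)$ corresponds to the kernel of the homomorphism $F_n\to G$ induced by mapping a fixed basis of $F_n$ to $X$. It carries the topology induced from the product topology on $2^{F_n}$. The group $\mathrm{Aut}(F_n)$ acts on the set of normal subgroups of $F_n$ by $\alpha\cdot N=\alpha(N)$; inner automorphisms act trivially, so this induces an action of $\mathrm{Out}(F_n)$ on $\mathcal G_n$ by homeomorphisms. A probability measure on $\mathcal G_n$ is a countably additive measure $\mu$ on the Borel $\sigma$-algebra with $\mu(\mathcal G_n)=1$; it is $\mathrm{Out}(F_n)$-invariant if $\mu(gA)=\mu(A)$ for all Borel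 $A$ and $g\in\mathrm{Out}(F_n)$; an invariant $\mu$ is ergodic if $\mu(A)\in\{0,1\}$ for every $\mathrm{Out}(F_n)$-invariant Borel set $A$. $\mathcal L$ is the first order language of groups with signature $\{\cdot,{}^{-1},1\}$, and $\mathcal L_{\omega_1,\omega}$ is its infinitary version, where countable conjunctions and disjunctions (but only finite sequences of quantifiers) are allowed. For a countable set $F$ of $\mathcal L_{\omega_1,\omega}$-sentences, $G\equiv_F H$ means that for every $\sigma\in F$, $G\models\sigma$ if and only if $H\models\sigma$. Elementary equivalence is $\equiv_F$ for $F$ the set of all first order $\mathcal L$-sentences. *)

theory Defs
  imports "HOL-Probability.Probability" "HOL-Algebra.Bij" "HOL-Algebra.Generated_Groups"
begin

section \<open>The free group of rank n\<close>

text \<open>A letter \<open>(i, True)\<close> stands for the basis element \<open>x\<^sub>i\<close> and \<open>(i, False)\<close> for its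
  inverse. Elements of the free group are the reduced words in the letters with \<open>i < n\<close>.\<close>

type_synonym letter = "nat \<times> bool"
type_synonym fg_word = "letter list"

definition inv_letter :: "letter \<Rightarrow> letter" where
  "inv_letter x = (fst x, \<not> snd x)"

definition reduced_word :: "fg_word \<Rightarrow> bool" where
  "reduced_word w \<longleftrightarrow> successively (\<lambda>x y. y \<noteq> inv_letter x) w"

text \<open>Left multiplication of a reduced word by a letter, with cancellation.\<close>

fun rcons :: "letter \<Rightarrow> fg_word \<Rightarrow> fg_word" where
  "rcons x [] = [x]"
| "rcons x (y # w) = (if y = inv_letter x then w else x # y # w)"

definition free_group :: "nat \<Rightarrow> fg_word monoid" where
  "free_group n =
     \<lparr>carrier = {w. reduced_word w \<and> fst ` set w \<subseteq> {..<n}},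
      mult = (\<lambda>u v. foldr rcons u v),
      one = []\<rparr>"

lemma inv_letter_inv_letter [simp]: "inv_letter (inv_letter x) = x"
  by (simp add: inv_letter_def)

lemma inv_letter_neq [simp]: "inv_letter x \<noteq> x" "x \<noteq> inv_letter x"
  by (auto simp: inv_letter_def prod_eq_iff)

lemma fst_inv_letter [simp]: "fst (inv_letter x) = fst x"
  by (simp add: inv_letter_def)

lemma reduced_Nil [simp]: "reduced_word []"
  by (simp add: reduced_word_def)

lemma reduced_Cons: "reduced_word (x # w) \<longleftrightarrow> (w = [] \<or> hd w \<noteq> inv_letter x) \<and> reduced_word w"
  by (auto simp: reduced_word_def successively_Cons)

lemma reduced_rcons: "reduced_word w \<Longrightarrow> reduced_word (rcons x w)"
  by (cases w) (auto simp: reduced_Cons)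

lemma reduced_foldr: "reduced_word w \<Longrightarrow> reduced_word (foldr rcons u w)"
  by (induction u) (auto simp: reduced_rcons)

lemma set_rcons: "set (rcons x w) \<subseteq> insert x (set w)"
  by (cases w) auto

lemma set_foldr_rcons: "set (foldr rcons u w) \<subseteq> set u \<union> set w"
proof (induction u)
  case (Cons x u)
  then show ?case using set_rcons[of x "foldr rcons u w"] by auto
qed simp

lemma rcons_cancel: "reduced_word w \<Longrightarrow> rcons (inv_letter x) (rcons x w) = w"
proof (induction x w rule: rcons.induct)
  case (2 x y u)
  then show ?case by (cases u) (auto simp: reduced_Cons)
qed simp

lemma rcons_reduced: "reduced_word (x # w) \<Longrightarrow> rcons x w = x # w"
  by (cases w) (auto simp: reduced_Cons)

lemma foldr_rcons_Nil: "reduced_word w \<Longrightarrow> foldr rcons w [] = w"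
  by (induction w) (auto simp: rcons_reduced reduced_Cons)

lemma foldr_rcons_rcons:
  assumes "reduced_word w"
  shows "foldr rcons (rcons x v) w = rcons x (foldr rcons v w)"
proof (cases v)
  case (Cons y u)
  then show ?thesis
    using rcons_cancel[OF reduced_foldr[OF assms], of "inv_letter x" u] by auto
qed simp

lemma foldr_rcons_assoc:
  "reduced_word w \<Longrightarrow> foldr rcons (foldr rcons u v) w = foldr rcons u (foldr rcons v w)"
  by (induction u) (auto simp: foldr_rcons_rcons)

lemma foldr_rcons_inverse:
  "reduced_word w \<Longrightarrow> foldr rcons (rev (map inv_letter w)) w = []"
  by (induction w) (auto simp: reduced_Cons)

lemma reduced_inverse: "reduced_word w \<Longrightarrow> reduced_word (rev (map inv_letter w))"
proof (induction w)
  case (Cons x w)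
  then show ?case
    by (cases w) (auto simp: reduced_word_def successively_append_iff successively_Cons)
qed simp

lemma group_free_group: "group (free_group n)"
proof (rule groupI)
  fix x y
  assume xy: "x \<in> carrier (free_group n)" "y \<in> carrier (free_group n)"
  have "fst ` set (foldr rcons x y) \<subseteq> fst ` (set x \<union> set y)"
    by (intro image_mono set_foldr_rcons)
  also have "\<dots> \<subseteq> {..<n}"
    using xy unfolding image_Un by (simp add: free_group_def)
  finally show "x \<otimes>\<^bsub>free_group n\<^esub> y \<in> carrier (free_group n)"
    using xy reduced_foldr[of y x] by (simp add: free_group_def)
next
  fix x
  assume "x \<in> carrier (free_group n)"
  then show "\<exists>y\<in>carrier (free_group n). y \<otimes>\<^bsub>free_group n\<^esub> x = \<one>\<^bsub>free_group n\<^esub>"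
    by (intro bexI[of _ "rev (map inv_letter x)"])
       (auto simp: free_group_def foldr_rcons_inverse reduced_inverse)
qed (auto simp: free_group_def foldr_rcons_assoc)

section \<open>The space of marked groups\<close>

text \<open>A tuple \<open>(x\<^sub>0, \<dots>, x\<^sub>n\<^sub>-\<^sub>1)\<close> is a function of which only the values below \<open>n\<close> matter.\<close>

definition marked_group :: "nat \<Rightarrow> ('a, 'm) monoid_scheme \<Rightarrow> (nat \<Rightarrow> 'a) \<Rightarrow> bool" where
  "marked_group n G X \<longleftrightarrow>
     group G \<and> X ` {..<n} \<subseteq> carrier G \<and> generate G (X ` {..<n}) = carrier G"

definition marked_iso ::
  "nat \<Rightarrow> ('a, 'm) monoid_scheme \<Rightarrow> (nat \<Rightarrow> 'a) \<Rightarrow> ('b, 'k) monoid_scheme \<Rightarrow> (nat \<Rightarrow> 'b) \<Rightarrow> bool" where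
  "marked_iso n G X H Y \<longleftrightarrow> (\<exists>h\<in>iso G H. \<forall>i<n. h (X i) = Y i)"

definition letter_eval :: "('a, 'm) monoid_scheme \<Rightarrow> (nat \<Rightarrow> 'a) \<Rightarrow> letter \<Rightarrow> 'a" where
  "letter_eval G X x = (if snd x then X (fst x) else inv\<^bsub>G\<^esub> (X (fst x)))"

definition word_eval :: "('a, 'm) monoid_scheme \<Rightarrow> (nat \<Rightarrow> 'a) \<Rightarrow> fg_word \<Rightarrow> 'a" where
  "word_eval G X w = foldr (\<lambda>x g. letter_eval G X x \<otimes>\<^bsub>G\<^esub> g) w \<one>\<^bsub>G\<^esub>"

definition marked_kernel :: "nat \<Rightarrow> ('a, 'm) monoid_scheme \<Rightarrow> (nat \<Rightarrow> 'a) \<Rightarrow> fg_word set" where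
  "marked_kernel n G X = kernel (free_group n) G (word_eval G X)"

text \<open>The space of n-generated marked groups is identified with the set of normal subgroups of
  the free group: a normal subgroup \<open>N\<close> is the class of \<open>free_group n Mod N\<close>, marked by
  the images of the basis, and a marked group \<open>(G, X)\<close> is represented by \<open>marked_kernel n G X\<close>.
  The lemmas \<open>marked_kernel_quotient\<close>, \<open>marked_kernel_normal\<close> and
  \<open>marked_iso_iff_kernel_eq\<close> below justify this.\<close>

definition marked_groups :: "nat \<Rightarrow> fg_word set set" where
  "marked_groups n = {N. N \<lhd> free_group n}"

text \<open>The topology induced from the product topology on the set of all subsets of the free group,
  a subset being regarded as its (extensional) indicator function.\<close>

definition marked_groups_topology :: "nat \<Rightarrow> fg_word set topology" where
  "marked_groups_topology n =
     pullback_topology (marked_groups n) (\<lambda>N. \<lambda>w\<in>carrier (free_group n). w \<in> N)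
       (product_topology (\<lambda>w. discrete_topology (UNIV :: bool set)) (carrier (free_group n)))"

definition marked_groups_borel :: "nat \<Rightarrow> fg_word set measure" where
  "marked_groups_borel n = sigma (marked_groups n) {U. openin (marked_groups_topology n) U}"

lemma topspace_marked_groups: "topspace (marked_groups_topology n) = marked_groups n"
  by (auto simp: marked_groups_topology_def topspace_pullback_topology)

lemma space_marked_groups_borel: "space (marked_groups_borel n) = marked_groups n"
  by (simp add: marked_groups_borel_def space_measure_of_conv)

lemma sets_marked_groups_borel:
  "sets (marked_groups_borel n) =
     sigma_sets (marked_groups n) {U. openin (marked_groups_topology n) U}"
  unfolding marked_groups_borel_def
  using openin_subset[of "marked_groups_topology n"]
  by (intro sets_measure_of) (auto simp: topspace_marked_groups)

lemma letter_eval_closed: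
  assumes "marked_group n G X" "fst x < n"
  shows "letter_eval G X x \<in> carrier G"
proof -
  interpret group G using assms by (simp add: marked_group_def)
  show ?thesis using assms by (auto simp: letter_eval_def marked_group_def)
qed

lemma word_eval_Nil [simp]: "word_eval G X [] = \<one>\<^bsub>G\<^esub>"
  by (simp add: word_eval_def)

lemma word_eval_Cons [simp]:
  "word_eval G X (x # w) = letter_eval G X x \<otimes>\<^bsub>G\<^esub> word_eval G X w"
  by (simp add: word_eval_def)

lemma word_eval_closed:
  assumes "marked_group n G X" "fst ` set w \<subseteq> {..<n}"
  shows "word_eval G X w \<in> carrier G"
proof -
  interpret group G using assms by (simp add: marked_group_def)
  show ?thesis using assms(2)
    by (induction w) (use letter_eval_closed[OF assms(1)] in auto)
qed

lemma word_eval_rcons: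
  assumes "marked_group n G X" "fst x < n" "fst ` set w \<subseteq> {..<n}"
  shows "word_eval G X (rcons x w) = letter_eval G X x \<otimes>\<^bsub>G\<^esub> word_eval G X w"
proof -
  interpret group G using assms by (simp add: marked_group_def)
  show ?thesis
  proof (cases w)
    case (Cons y u)
    show ?thesis
    proof (cases "y = inv_letter x")
      case True
      have c: "letter_eval G X x \<in> carrier G" "letter_eval G X y \<in> carrier G"
        "word_eval G X u \<in> carrier G" "X (fst x) \<in> carrier G"
        using assms Cons letter_eval_closed[OF assms(1)] word_eval_closed[OF assms(1), of u]
        by (auto simp: marked_group_def)
      have "letter_eval G X x \<otimes>\<^bsub>G\<^esub> letter_eval G X y = \<one>\<^bsub>G\<^esub>"
        using c True by (auto simp: letter_eval_def inv_letter_def)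
      then show ?thesis using c Cons True by (simp flip: m_assoc)
    qed (use Cons in simp)
  qed simp
qed

lemma word_eval_hom:
  assumes "marked_group n G X"
  shows "word_eval G X \<in> hom (free_group n) G"
proof -
  interpret group G using assms by (simp add: marked_group_def)
  have "word_eval G X (foldr rcons u v) = word_eval G X u \<otimes>\<^bsub>G\<^esub> word_eval G X v"
    if "fst ` set u \<subseteq> {..<n}" "fst ` set v \<subseteq> {..<n}" for u v
    using that
  proof (induction u)
    case Nil
    then show ?case using word_eval_closed[OF assms] by simp
  next
    case (Cons x u)
    have "fst ` set (foldr rcons u v) \<subseteq> {..<n}"
      using Cons.prems set_foldr_rcons[of u v] by fastforce
    then show ?case
      using Cons word_eval_rcons[OF assms, of x] word_eval_closed[OF assms]
        letter_eval_closed[OF assms, of x] by (simp add: m_assoc)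
  qed
  then show ?thesis
    using word_eval_closed[OF assms] by (auto simp: hom_def free_group_def)
qed

lemma group_hom_word_eval:
  "marked_group n G X \<Longrightarrow> group_hom (free_group n) G (word_eval G X)"
  by (intro group_hom.intro group_hom_axioms.intro group_free_group word_eval_hom)
     (auto simp: marked_group_def)

lemma basis_in_carrier: "i < n \<Longrightarrow> [(i, True)] \<in> carrier (free_group n)"
  by (simp add: free_group_def reduced_Cons)

lemma word_eval_basis:
  assumes "marked_group n G X" "i < n"
  shows "word_eval G X [(i, True)] = X i"
proof -
  interpret group G using assms by (simp add: marked_group_def)
  have "X i \<in> carrier G" using assms by (auto simp: marked_group_def)
  then show ?thesis by (simp add: letter_eval_def)
qed

lemma word_eval_surj:
  assumes "marked_group n G X"
  shows "word_eval G X ` carrier (free_group n) = carrier G"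
proof -
  interpret h: group_hom "free_group n" G "word_eval G X"
    by (rule group_hom_word_eval[OF assms])
  have "X ` {..<n} \<subseteq> word_eval G X ` carrier (free_group n)"
    using word_eval_basis[OF assms] basis_in_carrier by (force simp: image_iff)
  then have "generate G (X ` {..<n}) \<subseteq> word_eval G X ` carrier (free_group n)"
    by (intro h.H.generate_subgroup_incl h.img_is_subgroup)
  then show ?thesis using assms by (auto simp: marked_group_def)
qed

lemma marked_kernel_normal: "marked_group n G X \<Longrightarrow> marked_kernel n G X \<in> marked_groups n"
  using group_hom.normal_kernel[OF group_hom_word_eval]
  by (auto simp: marked_kernel_def marked_groups_def)

lemma quotient_marked_kernel_iso:
  "marked_group n G X \<Longrightarrow> (free_group n Mod marked_kernel n G X) \<cong> G"
  unfolding marked_kernel_def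
  by (intro group_hom.FactGroup_iso group_hom_word_eval word_eval_surj)

lemma hom_word_eval:
  assumes "group G" "group H" "h \<in> hom G H" "X ` {..<n} \<subseteq> carrier G" "fst ` set w \<subseteq> {..<n}"
  shows "h (word_eval G X w) = word_eval H (\<lambda>i. h (X i)) w \<and> word_eval G X w \<in> carrier G"
proof -
  interpret group_hom G H h using assms by (simp add: group_hom_def group_hom_axioms_def)
  show ?thesis using assms(5)
  proof (induction w)
    case (Cons x w)
    have "X (fst x) \<in> carrier G" using Cons.prems assms(4) by auto
    then show ?case using Cons by (auto simp: letter_eval_def)
  qed simp
qed

lemma word_eval_cong:
  "(\<And>i. i < n \<Longrightarrow> X i = Y i) \<Longrightarrow> fst ` set w \<subseteq> {..<n} \<Longrightarrow> word_eval G X w = word_eval G Y w"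
  by (induction w) (auto simp: letter_eval_def)

lemma word_eval_free_group:
  assumes "w \<in> carrier (free_group n)"
  shows "word_eval (free_group n) (\<lambda>i. [(i, True)]) w = w"
proof -
  have inv: "inv\<^bsub>free_group n\<^esub> [(i, True)] = [(i, False)]" if "i < n" for i
    using that
    by (intro group.inv_equality[OF group_free_group])
       (auto simp: free_group_def reduced_Cons inv_letter_def)
  have le: "letter_eval (free_group n) (\<lambda>i. [(i, True)]) x = [x]" if "fst x < n" for x
    using that inv by (cases x) (auto simp: letter_eval_def)
  from assms show ?thesis
  proof (induction w)
    case (Cons x w)
    then have "w \<in> carrier (free_group n)" "fst x < n" "reduced_word (x # w)"
      by (auto simp: free_group_def reduced_Cons)
    with Cons le[of x] rcons_reduced[of x w] show ?case by (simp add: free_group_def)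
  qed (simp add: free_group_def)
qed

lemma marked_kernel_quotient:
  assumes "N \<in> marked_groups n"
  defines "X \<equiv> \<lambda>i. N #>\<^bsub>free_group n\<^esub> [(i, True)]"
  shows "marked_group n (free_group n Mod N) X"
    and "marked_kernel n (free_group n Mod N) X = N"
proof -
  interpret N: normal N "free_group n" using assms by (simp add: marked_groups_def)
  let ?Q = "free_group n Mod N" and ?h = "\<lambda>w. N #>\<^bsub>free_group n\<^esub> w"
  have Q: "group ?Q" by (rule N.factorgroup_is_group)
  interpret h: group_hom "free_group n" ?Q ?h
    by (intro group_hom.intro group_hom_axioms.intro N.r_coset_hom_Mod Q group_free_group)
  have sub: "X ` {..<n} \<subseteq> carrier ?Q"
    using basis_in_carrier h.hom_closed by (auto simp: X_def)
  have ev: "word_eval ?Q X w = ?h w" if "w \<in> carrier (free_group n)" for w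
  proof -
    have "(\<lambda>i. [(i, True)]) ` {..<n} \<subseteq> carrier (free_group n)"
      using basis_in_carrier by auto
    moreover have "fst ` set w \<subseteq> {..<n}" using that by (simp add: free_group_def)
    ultimately have "?h (word_eval (free_group n) (\<lambda>i. [(i, True)]) w) = word_eval ?Q X w"
      unfolding X_def by (rule hom_word_eval[OF group_free_group Q N.r_coset_hom_Mod, THEN conjunct1])
    then show ?thesis unfolding word_eval_free_group[OF that] by (rule sym)
  qed
  have gen: "word_eval ?Q X w \<in> generate ?Q (X ` {..<n})" if "fst ` set w \<subseteq> {..<n}" for w
    using that
  proof (induction w)
    case (Cons x w)
    then have "letter_eval ?Q X x \<in> generate ?Q (X ` {..<n})"
      by (auto simp: letter_eval_def intro: generate.incl generate.inv)
    moreover have "word_eval ?Q X w \<in> generate ?Q (X ` {..<n})"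
      using Cons by simp
    ultimately show ?case unfolding word_eval_Cons by (rule generate.eng)
  qed (simp only: word_eval_Nil generate.one)
  have "carrier ?Q \<subseteq> generate ?Q (X ` {..<n})"
  proof
    fix c assume "c \<in> carrier ?Q"
    then obtain w where "w \<in> carrier (free_group n)" "c = ?h w"
      by (auto simp: FactGroup_def RCOSETS_def)
    then show "c \<in> generate ?Q (X ` {..<n})"
      using ev[of w] gen[of w] by (auto simp: free_group_def)
  qed
  moreover have "generate ?Q (X ` {..<n}) \<subseteq> carrier ?Q"
    using group.generate_incl[OF Q sub] .
  ultimately show "marked_group n ?Q X"
    using Q sub by (simp add: marked_group_def)
  show "marked_kernel n ?Q X = N"
    using ev N.coset_join1[OF _ _ N.subgroup_axioms] N.coset_join2[OF _ N.subgroup_axioms] N.subset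
    by (auto simp: marked_kernel_def kernel_def)
qed

lemma hom_image_coset:
  assumes "group_hom G H h" "x \<in> carrier G"
  shows "h ` (kernel G H h #>\<^bsub>G\<^esub> x) = {h x}"
proof -
  interpret group_hom G H h by fact
  have "h (k \<otimes>\<^bsub>G\<^esub> x) = h x" if "k \<in> kernel G H h" for k
    using that assms(2) by (auto simp: kernel_def)
  moreover have "\<one>\<^bsub>G\<^esub> \<in> kernel G H h" by (simp add: kernel_def)
  ultimately show ?thesis unfolding r_coset_def image_UN by auto
qed

lemma marked_iso_iff_kernel_eq:
  assumes "marked_group n G X" "marked_group n H Y"
  shows "marked_iso n G X H Y \<longleftrightarrow> marked_kernel n G X = marked_kernel n H Y"
proof
  interpret g: group_hom "free_group n" G "word_eval G X"
    by (rule group_hom_word_eval[OF assms(1)])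
  interpret h: group_hom "free_group n" H "word_eval H Y"
    by (rule group_hom_word_eval[OF assms(2)])
  {
    assume "marked_iso n G X H Y"
    then obtain f where f: "f \<in> iso G H" "\<And>i. i < n \<Longrightarrow> f (X i) = Y i"
      by (auto simp: marked_iso_def)
    interpret f: group_hom G H f
      using f by unfold_locales (auto simp: iso_def)
    have "f (word_eval G X w) = word_eval H Y w" if "w \<in> carrier (free_group n)" for w
      using hom_word_eval[OF g.H.is_group h.H.is_group f.homh, of X n w] assms(1) that
        word_eval_cong[of n "\<lambda>i. f (X i)" Y w H] f(2)
      by (auto simp: marked_group_def free_group_def)
    moreover have "f a = \<one>\<^bsub>H\<^esub> \<longleftrightarrow> a = \<one>\<^bsub>G\<^esub>" if "a \<in> carrier G" for a
      using f(1) that f.hom_one g.H.one_closed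
      by (metis (no_types, lifting) bij_betw_imp_inj_on inj_onD iso_def mem_Collect_eq)
    ultimately show "marked_kernel n G X = marked_kernel n H Y"
      using g.hom_closed unfolding marked_kernel_def kernel_def by (metis (mono_tags, lifting))
  next
    assume eq: "marked_kernel n G X = marked_kernel n H Y"
    let ?K = "marked_kernel n G X"
    let ?g = "\<lambda>c. the_elem (word_eval G X ` c)" and ?h = "\<lambda>c. the_elem (word_eval H Y ` c)"
    have g: "?g \<in> iso (free_group n Mod ?K) G"
      using g.FactGroup_iso_set[OF word_eval_surj[OF assms(1)]] by (simp add: marked_kernel_def)
    have h: "?h \<in> iso (free_group n Mod ?K) H"
      unfolding eq
      using h.FactGroup_iso_set[OF word_eval_surj[OF assms(2)]] by (simp add: marked_kernel_def)
    interpret K: normal ?K "free_group n"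
      using marked_kernel_normal[OF assms(1)] by (simp add: marked_groups_def)
    let ?c = "\<lambda>i. ?K #>\<^bsub>free_group n\<^esub> [(i, True)]"
    have c: "?c i \<in> carrier (free_group n Mod ?K)" if "i < n" for i
      using basis_in_carrier[OF that] by (auto simp: FactGroup_def RCOSETS_def)
    have gc: "?g (?c i) = X i" if "i < n" for i
      unfolding marked_kernel_def
      by (simp only: hom_image_coset[OF g.group_hom_axioms basis_in_carrier[OF that]]
          word_eval_basis[OF assms(1) that] the_elem_eq)
    have hc: "?h (?c i) = Y i" if "i < n" for i
      unfolding eq unfolding marked_kernel_def
      by (simp only: hom_image_coset[OF h.group_hom_axioms basis_in_carrier[OF that]]
          word_eval_basis[OF assms(2) that] the_elem_eq)
    let ?g' = "inv_into (carrier (free_group n Mod ?K)) ?g"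
    have "?g' \<in> iso G (free_group n Mod ?K)"
      by (rule group.iso_set_sym[OF K.factorgroup_is_group g])
    then have "?h \<circ> ?g' \<in> iso G H"
      using h by (rule iso_set_trans)
    moreover have "(?h \<circ> ?g') (X i) = Y i" if "i < n" for i
    proof -
      have "inj_on ?g (carrier (free_group n Mod ?K))"
        using g by (auto simp: iso_def bij_betw_def)
      then have "?g' (?g (?c i)) = ?c i"
        using c[OF that] by (rule inv_into_f_f)
      then show ?thesis using gc[OF that] hc[OF that] by simp
    qed
    ultimately show "marked_iso n G X H Y" unfolding marked_iso_def by blast
  }
qed

section \<open>The action of Out\<close>

definition inner_auts :: "('a, 'm) monoid_scheme \<Rightarrow> ('a \<Rightarrow> 'a) set" where
  "inner_auts G = (\<lambda>g. \<lambda>x\<in>carrier G. g \<otimes>\<^bsub>G\<^esub> x \<otimes>\<^bsub>G\<^esub> inv\<^bsub>G\<^esub> g) ` carrier G"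

definition Out :: "('a, 'm) monoid_scheme \<Rightarrow> ('a \<Rightarrow> 'a) set monoid" where
  "Out G = AutoGroup G Mod inner_auts G"

text \<open>All automorphisms in one class of \<open>Out G\<close> send a normal subgroup to the same normal
  subgroup, see \<open>out_act_eq\<close> below; this common image is the value of the action.\<close>

definition out_act :: "('a \<Rightarrow> 'a) set \<Rightarrow> 'a set \<Rightarrow> 'a set" where
  "out_act c N = (THE M. \<forall>\<alpha>\<in>c. \<alpha> ` N = M)"

lemma out_act_eq:
  assumes "group G" "N \<lhd> G" "c \<in> carrier (Out G)" "\<alpha> \<in> c"
  shows "out_act c N = \<alpha> ` N"
proof -
  interpret N: normal N G by fact
  have cancel: "inv\<^bsub>G\<^esub> a \<otimes>\<^bsub>G\<^esub> (a \<otimes>\<^bsub>G\<^esub> b) = b" "a \<otimes>\<^bsub>G\<^esub> (inv\<^bsub>G\<^esub> a \<otimes>\<^bsub>G\<^esub> b) = b"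
    if "a \<in> carrier G" "b \<in> carrier G" for a b
    using that by (simp_all flip: N.m_assoc)
  obtain \<beta> where \<beta>: "\<beta> \<in> auto G" "c = inner_auts G #>\<^bsub>AutoGroup G\<^esub> \<beta>"
    using assms(3) by (auto simp: Out_def FactGroup_def RCOSETS_def AutoGroup_def)
  have \<beta>_Bij: "\<beta> \<in> Bij (carrier G)" and \<beta>_hom: "group_hom G G \<beta>"
    using \<beta>(1) assms(1) by (auto simp: auto_def group_hom_def group_hom_axioms_def)
  interpret \<beta>: group_hom G G \<beta> by (rule \<beta>_hom)
  have onto: "\<beta> ` carrier G = carrier G"
    using \<beta>_Bij by (auto simp: Bij_def bij_betw_def)
  have img: "\<gamma> ` N = \<beta> ` N" if \<gamma>_in: "\<gamma> \<in> c" for \<gamma>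
  proof -
    obtain f where f: "f \<in> inner_auts G" "\<gamma> = f \<otimes>\<^bsub>AutoGroup G\<^esub> \<beta>"
      using \<gamma>_in by (auto simp: \<beta>(2) r_coset_def)
    obtain g where g: "g \<in> carrier G"
      and f_eq: "f = (\<lambda>x\<in>carrier G. g \<otimes>\<^bsub>G\<^esub> x \<otimes>\<^bsub>G\<^esub> inv\<^bsub>G\<^esub> g)"
      using f(1) unfolding inner_auts_def by (rule imageE)
    have \<gamma>: "\<gamma> = (\<lambda>x\<in>carrier G. g \<otimes>\<^bsub>G\<^esub> x \<otimes>\<^bsub>G\<^esub> inv\<^bsub>G\<^esub> g) \<otimes>\<^bsub>AutoGroup G\<^esub> \<beta>"
      using f(2) f_eq by simp
    have "bij_betw (\<lambda>x. g \<otimes>\<^bsub>G\<^esub> x \<otimes>\<^bsub>G\<^esub> inv\<^bsub>G\<^esub> g) (carrier G) (carrier G)"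
      using g
      by (intro bij_betw_byWitness[where f' = "\<lambda>x. inv\<^bsub>G\<^esub> g \<otimes>\<^bsub>G\<^esub> x \<otimes>\<^bsub>G\<^esub> g"])
         (auto simp: N.m_assoc cancel)
    then have "(\<lambda>x\<in>carrier G. g \<otimes>\<^bsub>G\<^esub> x \<otimes>\<^bsub>G\<^esub> inv\<^bsub>G\<^esub> g) \<in> Bij (carrier G)"
      by (simp add: Bij_def bij_betw_restrict_eq)
    then have \<gamma>': "\<gamma> x = g \<otimes>\<^bsub>G\<^esub> \<beta> x \<otimes>\<^bsub>G\<^esub> inv\<^bsub>G\<^esub> g" if "x \<in> carrier G" for x
      using \<gamma> \<beta>_Bij that by (simp add: AutoGroup_def BijGroup_def compose_def)
    obtain k where k: "k \<in> carrier G" "\<beta> k = g" using onto g by (metis imageE)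
    have conj: "\<gamma> x = \<beta> (k \<otimes>\<^bsub>G\<^esub> x \<otimes>\<^bsub>G\<^esub> inv\<^bsub>G\<^esub> k)" if "x \<in> carrier G" for x
      using \<gamma>' that k by simp
    have sub: "\<gamma> ` N \<subseteq> \<beta> ` N"
    proof
      fix y assume "y \<in> \<gamma> ` N"
      then obtain x where x: "x \<in> N" "y = \<gamma> x" by auto
      then have "k \<otimes>\<^bsub>G\<^esub> x \<otimes>\<^bsub>G\<^esub> inv\<^bsub>G\<^esub> k \<in> N" "x \<in> carrier G"
        using N.inv_op_closed2[OF k(1)] N.mem_carrier by auto
      then show "y \<in> \<beta> ` N" using conj x(2) by blast
    qed
    have "\<beta> ` N \<subseteq> \<gamma> ` N"
    proof
      fix y assume "y \<in> \<beta> ` N"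
      then obtain x where x: "x \<in> N" "y = \<beta> x" by auto
      let ?z = "inv\<^bsub>G\<^esub> k \<otimes>\<^bsub>G\<^esub> x \<otimes>\<^bsub>G\<^esub> k"
      have z: "?z \<in> N" "?z \<in> carrier G" "x \<in> carrier G"
        using x k N.inv_op_closed1[OF k(1)] N.mem_carrier by auto
      have "k \<otimes>\<^bsub>G\<^esub> ?z \<otimes>\<^bsub>G\<^esub> inv\<^bsub>G\<^esub> k = x"
        using k z by (simp add: N.m_assoc cancel)
      then have "\<gamma> ?z = y" using conj[OF z(2)] x by simp
      then show "y \<in> \<gamma> ` N" using z(1) by blast
    qed
    then show ?thesis using sub by blast
  qed
  show ?thesis
    unfolding out_act_def
    using img img[OF assms(4)] assms(4) by (intro the_equality) auto
qed

definition out_invariant :: "nat \<Rightarrow> fg_word set measure \<Rightarrow> bool" where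
  "out_invariant n \<mu> \<longleftrightarrow>
     (\<forall>g\<in>carrier (Out (free_group n)). \<forall>A\<in>sets \<mu>. measure \<mu> (out_act g ` A) = measure \<mu> A)"

definition out_ergodic :: "nat \<Rightarrow> fg_word set measure \<Rightarrow> bool" where
  "out_ergodic n \<mu> \<longleftrightarrow>
     (\<forall>A\<in>sets \<mu>. (\<forall>g\<in>carrier (Out (free_group n)). out_act g ` A = A) \<longrightarrow> measure \<mu> A \<in> {0, 1})"

section \<open>The infinitary language of groups\<close>

datatype group_term = TVar nat | TOne | TMult group_term group_term | TInv group_term

text \<open>First order formulas extended by conjunctions and disjunctions of countable sequences of
  formulas. A quantifier binds a single variable, so there are no infinite quantifier strings.\<close>

datatype fm =
    FEq group_term group_term
  | FNeg fm
  | FAnd fm fm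
  | FOr fm fm
  | FAll nat fm
  | FEx nat fm
  | FConj "nat \<Rightarrow> fm"
  | FDisj "nat \<Rightarrow> fm"

primrec term_vars :: "group_term \<Rightarrow> nat set" where
  "term_vars (TVar i) = {i}"
| "term_vars TOne = {}"
| "term_vars (TMult s t) = term_vars s \<union> term_vars t"
| "term_vars (TInv t) = term_vars t"

primrec free_vars :: "fm \<Rightarrow> nat set" where
  "free_vars (FEq s t) = term_vars s \<union> term_vars t"
| "free_vars (FNeg \<phi>) = free_vars \<phi>"
| "free_vars (FAnd \<phi> \<psi>) = free_vars \<phi> \<union> free_vars \<psi>"
| "free_vars (FOr \<phi> \<psi>) = free_vars \<phi> \<union> free_vars \<psi>"
| "free_vars (FAll i \<phi>) = free_vars \<phi> - {i}"
| "free_vars (FEx i \<phi>) = free_vars \<phi> - {i}"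
| "free_vars (FConj \<Phi>) = (\<Union>k. free_vars (\<Phi> k))"
| "free_vars (FDisj \<Phi>) = (\<Union>k. free_vars (\<Phi> k))"

definition sentence :: "fm \<Rightarrow> bool" where
  "sentence \<phi> \<longleftrightarrow> free_vars \<phi> = {}"

primrec first_order :: "fm \<Rightarrow> bool" where
  "first_order (FEq s t) \<longleftrightarrow> True"
| "first_order (FNeg \<phi>) \<longleftrightarrow> first_order \<phi>"
| "first_order (FAnd \<phi> \<psi>) \<longleftrightarrow> first_order \<phi> \<and> first_order \<psi>"
| "first_order (FOr \<phi> \<psi>) \<longleftrightarrow> first_order \<phi> \<and> first_order \<psi>"
| "first_order (FAll i \<phi>) \<longleftrightarrow> first_order \<phi>"
| "first_order (FEx i \<phi>) \<longleftrightarrow> first_order \<phi>"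
| "first_order (FConj \<Phi>) \<longleftrightarrow> False"
| "first_order (FDisj \<Phi>) \<longleftrightarrow> False"

primrec term_val :: "('a, 'm) monoid_scheme \<Rightarrow> (nat \<Rightarrow> 'a) \<Rightarrow> group_term \<Rightarrow> 'a" where
  "term_val G v (TVar i) = v i"
| "term_val G v TOne = \<one>\<^bsub>G\<^esub>"
| "term_val G v (TMult s t) = term_val G v s \<otimes>\<^bsub>G\<^esub> term_val G v t"
| "term_val G v (TInv t) = inv\<^bsub>G\<^esub> (term_val G v t)"

primrec sat :: "('a, 'm) monoid_scheme \<Rightarrow> fm \<Rightarrow> (nat \<Rightarrow> 'a) \<Rightarrow> bool" where
  "sat G (FEq s t) = (\<lambda>v. term_val G v s = term_val G v t)"
| "sat G (FNeg \<phi>) = (\<lambda>v. \<not> sat G \<phi> v)"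
| "sat G (FAnd \<phi> \<psi>) = (\<lambda>v. sat G \<phi> v \<and> sat G \<psi> v)"
| "sat G (FOr \<phi> \<psi>) = (\<lambda>v. sat G \<phi> v \<or> sat G \<psi> v)"
| "sat G (FAll i \<phi>) = (\<lambda>v. \<forall>a\<in>carrier G. sat G \<phi> (v(i := a)))"
| "sat G (FEx i \<phi>) = (\<lambda>v. \<exists>a\<in>carrier G. sat G \<phi> (v(i := a)))"
| "sat G (FConj \<Phi>) = (\<lambda>v. \<forall>k. sat G (\<Phi> k) v)"
| "sat G (FDisj \<Phi>) = (\<lambda>v. \<exists>k. sat G (\<Phi> k) v)"

text \<open>For a sentence, satisfaction does not depend on the assignment.\<close>

definition models :: "('a, 'm) monoid_scheme \<Rightarrow> fm \<Rightarrow> bool" where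
  "models G \<phi> \<longleftrightarrow> (\<forall>v. range v \<subseteq> carrier G \<longrightarrow> sat G \<phi> v)"

definition equiv_for ::
  "fm set \<Rightarrow> ('a, 'm) monoid_scheme \<Rightarrow> ('b, 'k) monoid_scheme \<Rightarrow> bool" where
  "equiv_for F G H \<longleftrightarrow> (\<forall>\<sigma>\<in>F. models G \<sigma> \<longleftrightarrow> models H \<sigma>)"

definition elementarily_equivalent ::
  "('a, 'm) monoid_scheme \<Rightarrow> ('b, 'k) monoid_scheme \<Rightarrow> bool" where
  "elementarily_equivalent G H \<longleftrightarrow> equiv_for {\<sigma>. first_order \<sigma> \<and> sentence \<sigma>} G H"

lemma term_val_cong:
  "(\<And>i. i \<in> term_vars t \<Longrightarrow> v i = w i) \<Longrightarrow> term_val G v t = term_val G w t"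
  by (induction t) auto

lemma sat_cong:
  "(\<And>i. i \<in> free_vars \<phi> \<Longrightarrow> v i = w i) \<Longrightarrow> sat G \<phi> v \<longleftrightarrow> sat G \<phi> w"
proof (induction \<phi> arbitrary: v w)
  case (FEq s t)
  then have "term_val G v s = term_val G w s" "term_val G v t = term_val G w t"
    by (auto intro: term_val_cong)
  then show ?case by simp
next
  case (FAll i \<phi>)
  have "sat G \<phi> (v(i := a)) \<longleftrightarrow> sat G \<phi> (w(i := a))" for a
    using FAll.prems by (intro FAll.IH) auto
  then show ?case by simp
next
  case (FEx i \<phi>)
  have "sat G \<phi> (v(i := a)) \<longleftrightarrow> sat G \<phi> (w(i := a))" for a
    using FEx.prems by (intro FEx.IH) auto
  then show ?case by simp
next
  case (FNeg \<phi>)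
  then show ?case by (metis free_vars.simps(2) sat.simps(2))
next
  case (FAnd \<phi> \<psi>)
  have "sat G \<phi> v \<longleftrightarrow> sat G \<phi> w" "sat G \<psi> v \<longleftrightarrow> sat G \<psi> w"
    using FAnd.prems by (auto intro!: FAnd.IH)
  then show ?case by simp
next
  case (FOr \<phi> \<psi>)
  have "sat G \<phi> v \<longleftrightarrow> sat G \<phi> w" "sat G \<psi> v \<longleftrightarrow> sat G \<psi> w"
    using FOr.prems by (auto intro!: FOr.IH)
  then show ?case by simp
next
  case (FConj \<Phi>)
  have "sat G (\<Phi> k) v \<longleftrightarrow> sat G (\<Phi> k) w" for k
    using FConj.prems by (intro FConj.IH) auto
  then show ?case by simp
next
  case (FDisj \<Phi>)
  have "sat G (\<Phi> k) v \<longleftrightarrow> sat G (\<Phi> k) w" for k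
    using FDisj.prems by (intro FDisj.IH) auto
  then show ?case by simp
qed

lemma models_iff_sat: 
  assumes "sentence \<phi>" "range v \<subseteq> carrier G"
  shows "models G \<phi> \<longleftrightarrow> sat G \<phi> v"
  using assms sat_cong[of \<phi>] unfolding models_def sentence_def by blast

lemma sat_iso:
  assumes "group G" "group H" "h \<in> iso G H" "range v \<subseteq> carrier G"
  shows "sat G \<phi> v \<longleftrightarrow> sat H \<phi> (h \<circ> v)"
  using assms(4)
proof (induction \<phi> arbitrary: v)
  interpret group_hom G H h
    using assms by (simp add: group_hom_def group_hom_axioms_def iso_def)
  have onto: "h ` carrier G = carrier H" and inj: "inj_on h (carrier G)"
    using assms(3) by (auto simp: iso_def bij_betw_def)
  have upd: "h \<circ> v(i := a) = (h \<circ> v)(i := h a)" for v :: "nat \<Rightarrow> 'a" and i a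
    by auto
  have rng: "range (v(i := a)) \<subseteq> carrier G"
    if "range v \<subseteq> carrier G" "a \<in> carrier G" for v i a
    using that by auto
  {
    case (FEq s t)
    have "h (term_val G v t) = term_val H (h \<circ> v) t \<and> term_val G v t \<in> carrier G" for t
      using FEq by (induction t) auto
    then show ?case using inj_on_eq_iff[OF inj] by (metis sat.simps(1))
  next
    case (FAll i \<phi>)
    have "sat G \<phi> (v(i := a)) \<longleftrightarrow> sat H \<phi> ((h \<circ> v)(i := h a))" if "a \<in> carrier G" for a
      using FAll.IH[OF rng[OF FAll.prems that], of i] upd by metis
    then show ?case by (simp add: comp_def flip: onto)
  next
    case (FEx i \<phi>)
    have "sat G \<phi> (v(i := a)) \<longleftrightarrow> sat H \<phi> ((h \<circ> v)(i := h a))" if "a \<in> carrier G" for a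
      using FEx.IH[OF rng[OF FEx.prems that], of i] upd by metis
    then show ?case by (simp add: comp_def flip: onto)
  }
qed simp_all

lemma iso_imp_equiv_for:
  assumes "group G" "group H" "G \<cong> H" "\<forall>\<sigma>\<in>F. sentence \<sigma>"
  shows "equiv_for F G H"
proof -
  obtain h where h: "h \<in> iso G H" using assms(3) by (auto simp: is_iso_def)
  have 1: "range (\<lambda>i::nat. \<one>\<^bsub>G\<^esub>) \<subseteq> carrier G"
    using group.is_monoid[OF assms(1)] by (auto intro: monoid.one_closed)
  then have 2: "range (h \<circ> (\<lambda>i::nat. \<one>\<^bsub>G\<^esub>)) \<subseteq> carrier H"
    using h by (auto simp: iso_def hom_def)
  show ?thesis
    unfolding equiv_for_def
  proof
    fix \<sigma> assume "\<sigma> \<in> F"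
    then have "sentence \<sigma>" using assms(4) by blast
    then show "models G \<sigma> \<longleftrightarrow> models H \<sigma>"
      by (simp only: models_iff_sat[OF _ 1] models_iff_sat[OF _ 2] sat_iso[OF assms(1,2) h 1])
  qed
qed

end

theory Submission
  imports Defs
begin

text \<open>Satisfaction of a formula in \<open>F\<^sub>n / N\<close> by elements named by words is a Borel condition on \<open>N\<close>,
  by induction on the formula: equations are open conditions, and a quantifier over the quotient is
  a countable one over words. The set of \<open>N\<close> whose quotient models a sentence is invariant because
  automorphisms of \<open>F\<^sub>n\<close> do not change the isomorphism type of the quotient, so by ergodicity it is
  null or conull; intersect these sets, or their complements, over the countably many sentences.\<close>

section \<open>Measurability of satisfaction\<close>

lemma countable_free_group: "countable (carrier (free_group n))"
  by (rule countableI_type)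

text \<open>This is the preimage of \<open>{True}\<close> under the coordinate projection at
  \<open>w\<close>, hence a subbasic open set of the pulled back product topology.\<close>

lemma sets_marked_groups_mem:
  assumes "w \<in> carrier (free_group n)"
  shows "{N \<in> marked_groups n. w \<in> N} \<in> sets (marked_groups_borel n)"
proof -
  let ?P = "product_topology (\<lambda>w. discrete_topology (UNIV :: bool set)) (carrier (free_group n))"
  have "openin ?P {f \<in> topspace ?P. f w \<in> {True}}"
    using continuous_map_product_projection[OF assms]
    by (rule openin_continuous_map_preimage) simp
  then have "openin (marked_groups_topology n)
      ((\<lambda>N. \<lambda>w\<in>carrier (free_group n). w \<in> N) -` {f \<in> topspace ?P. f w \<in> {True}} \<inter> marked_groups n)"
    unfolding marked_groups_topology_def openin_pullback_topology by blast
  also have "(\<lambda>N. \<lambda>w\<in>carrier (free_group n). w \<in> N) -` {f \<in> topspace ?P. f w \<in> {True}} \<inter> marked_groups n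
      = {N \<in> marked_groups n. w \<in> N}"
    using assms by auto
  finally show ?thesis
    unfolding sets_marked_groups_borel by auto
qed

lemma term_val_hom:
  assumes "group_hom G H h" "range v \<subseteq> carrier G"
  shows "term_val G v t \<in> carrier G \<and> term_val H (\<lambda>i. h (v i)) t = h (term_val G v t)"
proof -
  interpret group_hom G H h by fact
  show ?thesis using assms(2) by (induction t) auto
qed

lemma group_hom_r_coset:
  assumes "N \<lhd> G"
  shows "group_hom G (G Mod N) (\<lambda>x. N #>\<^bsub>G\<^esub> x)"
proof -
  interpret normal N G by fact
  show ?thesis
    by (intro group_hom.intro group_hom_axioms.intro r_coset_hom_Mod factorgroup_is_group is_group)
qed

text \<open>Turns an equation in the quotient into membership of one word, which is the open
  condition of \<open>sets_marked_groups_mem\<close>.\<close>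

lemma (in normal) r_coset_eq_iff:
  assumes "a \<in> carrier G" "b \<in> carrier G"
  shows "H #> a = H #> b \<longleftrightarrow> a \<otimes> inv b \<in> H"
proof -
  have "H #> a = H #> b \<longleftrightarrow> a \<in> H #> b"
    using assms repr_independence[OF _ _ subgroup_axioms] rcos_self[OF _ subgroup_axioms] by blast
  also have "\<dots> \<longleftrightarrow> a \<otimes> inv b \<in> H"
    using assms rcos_module[OF is_group] by simp
  finally show ?thesis .
qed

text \<open>The quotient varies with \<open>N\<close>, so an assignment is given by fixed words
  \<open>u\<close> whose cosets are taken in each quotient. The induction generalises
  \<open>u\<close> because a quantifier changes one of these words.\<close>

lemma sets_sat_FactGroup:
  assumes "range u \<subseteq> carrier (free_group n)"
  shows "{N \<in> marked_groups n. sat (free_group n Mod N) \<phi> (\<lambda>i. N #>\<^bsub>free_group n\<^esub> u i)}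
    \<in> sets (marked_groups_borel n)"
  using assms
proof (induction \<phi> arbitrary: u)
  let ?F = "free_group n" and ?B = "marked_groups_borel n"
  interpret F: group ?F by (rule group_free_group)
  note space = space_marked_groups_borel[symmetric]
  have upd: "(\<lambda>i. N #>\<^bsub>?F\<^esub> u i)(j := N #>\<^bsub>?F\<^esub> w) = (\<lambda>i. N #>\<^bsub>?F\<^esub> (u(j := w)) i)" for N u j w
    by (rule ext) simp
  have carr: "carrier (?F Mod N) = (\<lambda>w. N #>\<^bsub>?F\<^esub> w) ` carrier ?F" for N
    by (auto simp: FactGroup_def RCOSETS_def)
  have rng: "range (u(j := w)) \<subseteq> carrier ?F"
    if "range u \<subseteq> carrier ?F" "w \<in> carrier ?F" for u :: "nat \<Rightarrow> fg_word" and j w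
    using that by auto
  {
    case (FEq s t)
    let ?s = "term_val ?F u s" and ?t = "term_val ?F u t"
    have st: "?s \<in> carrier ?F" "?t \<in> carrier ?F"
      \<comment> \<open>The quotient by the trivial subgroup supplies a homomorphism out of
        \<open>?F\<close>; what is taken from it is that the terms evaluate inside
        \<open>?F\<close>.\<close>
      using term_val_hom[OF group_hom_r_coset[OF F.one_is_normal] FEq.prems] by auto
    have "sat (?F Mod N) (FEq s t) (\<lambda>i. N #>\<^bsub>?F\<^esub> u i) \<longleftrightarrow> ?s \<otimes>\<^bsub>?F\<^esub> inv\<^bsub>?F\<^esub> ?t \<in> N"
      if "N \<in> marked_groups n" for N
    proof -
      have N: "N \<lhd> ?F" using that by (simp add: marked_groups_def)
      show ?thesis
        using term_val_hom[OF group_hom_r_coset[OF N] FEq.prems]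
          normal.r_coset_eq_iff[OF N st] by simp
    qed
    then have "{N \<in> marked_groups n. sat (?F Mod N) (FEq s t) (\<lambda>i. N #>\<^bsub>?F\<^esub> u i)}
        = {N \<in> marked_groups n. ?s \<otimes>\<^bsub>?F\<^esub> inv\<^bsub>?F\<^esub> ?t \<in> N}" by blast
    then show ?case using st sets_marked_groups_mem by simp
  next
    case (FNeg \<phi>)
    then show ?case unfolding space sat.simps by (intro sets.sets_Collect_neg)
  next
    case (FAnd \<phi> \<psi>)
    then show ?case unfolding space sat.simps by (intro sets.sets_Collect_conj)
  next
    case (FOr \<phi> \<psi>)
    then show ?case unfolding space sat.simps by (intro sets.sets_Collect_disj)
  next
    case (FAll j \<phi>)
    \<comment> \<open>Every element of a quotient is the coset of a word, so the quantifier ranges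
      over one countable set that is the same for all \<open>N\<close>.\<close>
    have "{N \<in> space ?B. \<forall>w\<in>carrier ?F. sat (?F Mod N) \<phi> (\<lambda>i. N #>\<^bsub>?F\<^esub> (u(j := w)) i)} \<in> sets ?B"
      using FAll.IH[OF rng[OF FAll.prems], unfolded space]
      by (intro sets.sets_Collect_countable_All' countable_free_group)
    then show ?case by (simp add: space carr upd)
  next
    case (FEx j \<phi>)
    have "{N \<in> space ?B. \<exists>w\<in>carrier ?F. sat (?F Mod N) \<phi> (\<lambda>i. N #>\<^bsub>?F\<^esub> (u(j := w)) i)} \<in> sets ?B"
      using FEx.IH[OF rng[OF FEx.prems], unfolded space]
      by (intro sets.sets_Collect_countable_Ex' countable_free_group)
    then show ?case by (simp add: space carr upd)
  next
    case (FConj \<Phi>)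
    then show ?case unfolding space sat.simps by (intro sets.sets_Collect_countable_All) simp
  next
    case (FDisj \<Phi>)
    then show ?case unfolding space sat.simps by (intro sets.sets_Collect_countable_Ex) simp
  }
qed

lemma sets_models_FactGroup:
  assumes "sentence \<sigma>"
  shows "{N \<in> marked_groups n. models (free_group n Mod N) \<sigma>} \<in> sets (marked_groups_borel n)"
proof -
  interpret F: group "free_group n" by (rule group_free_group)
  \<comment> \<open>A sentence may be tested at any single assignment; the identity word names one
    in all quotients at once.\<close>
  let ?u = "\<lambda>_::nat. \<one>\<^bsub>free_group n\<^esub>"
  have "models (free_group n Mod N) \<sigma>
      \<longleftrightarrow> sat (free_group n Mod N) \<sigma> (\<lambda>i. N #>\<^bsub>free_group n\<^esub> ?u i)"
    if "N \<in> marked_groups n" for N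
    using that group_hom.hom_closed[OF group_hom_r_coset, of N "free_group n"]
    by (intro models_iff_sat[OF assms]) (auto simp: marked_groups_def)
  then have "{N \<in> marked_groups n. models (free_group n Mod N) \<sigma>}
      = {N \<in> marked_groups n. sat (free_group n Mod N) \<sigma> (\<lambda>i. N #>\<^bsub>free_group n\<^esub> ?u i)}"
    by blast
  then show ?thesis by (simp only:) (rule sets_sat_FactGroup, auto)
qed

section \<open>Invariance\<close>

lemma FactGroup_iso_image:
  assumes "group G" "N \<lhd> G" "\<alpha> \<in> iso G G"
  shows "\<alpha> ` N \<lhd> G" and "(G Mod \<alpha> ` N) \<cong> (G Mod N)"
proof -
  let ?\<beta> = "inv_into (carrier G) \<alpha>"
  let ?f = "(\<lambda>x. N #>\<^bsub>G\<^esub> x) \<circ> ?\<beta>"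
  interpret N: normal N G by fact
  interpret q: group_hom G "G Mod N" "\<lambda>x. N #>\<^bsub>G\<^esub> x" by (rule group_hom_r_coset[OF assms(2)])
  have bij: "bij_betw \<alpha> (carrier G) (carrier G)" and \<beta>: "?\<beta> \<in> iso G G"
    using assms group.iso_set_sym by (auto simp: iso_def)
  have "?f \<in> hom G (G Mod N)"
    using \<beta> q.homh by (intro hom_compose) (auto simp: iso_def)
  then interpret f: group_hom G "G Mod N" ?f by unfold_locales
  have im: "?\<beta> ` carrier G = carrier G" using \<beta> by (auto simp: iso_def bij_betw_def)
  have surj: "?f ` carrier G = carrier (G Mod N)"
    unfolding image_comp[symmetric] im by (auto simp: FactGroup_def RCOSETS_def)
  have kernel_q: "N #>\<^bsub>G\<^esub> x = \<one>\<^bsub>G Mod N\<^esub> \<longleftrightarrow> x \<in> N" if "x \<in> carrier G" for x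
    using that N.r_coset_eq_iff[OF that N.one_closed] q.hom_one by simp
  have ker: "kernel G (G Mod N) ?f = \<alpha> ` N"
  proof (intro equalityI subsetI)
    fix x assume "x \<in> kernel G (G Mod N) ?f"
    then have x: "x \<in> carrier G" "N #>\<^bsub>G\<^esub> ?\<beta> x = \<one>\<^bsub>G Mod N\<^esub>" by (auto simp: kernel_def)
    then have "?\<beta> x \<in> N" using kernel_q im by blast
    moreover have "\<alpha> (?\<beta> x) = x" using bij x(1) by (auto simp: bij_betw_def f_inv_into_f)
    ultimately show "x \<in> \<alpha> ` N" by force
  next
    fix x assume "x \<in> \<alpha> ` N"
    then obtain y where y: "y \<in> N" "x = \<alpha> y" by blast
    have yc: "y \<in> carrier G" using y(1) N.subset by blast
    then have "?\<beta> x = y" using bij y(2) by (simp add: bij_betw_def)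
    then show "x \<in> kernel G (G Mod N) ?f"
      using bij yc y kernel_q by (auto simp: kernel_def bij_betw_def)
  qed
  show "\<alpha> ` N \<lhd> G" using f.normal_kernel by (simp only: ker)
  show "(G Mod \<alpha> ` N) \<cong> (G Mod N)" using f.FactGroup_iso[OF surj] by (simp only: ker)
qed

text \<open>The action of a class is computed from a member of it by \<open>out_act_eq\<close>. A
  coset contains its representative since the identity is inner, being conjugation by
  \<open>\<one>\<close>.\<close>

lemma Out_representative:
  assumes "group G" "c \<in> carrier (Out G)"
  obtains \<alpha> where "\<alpha> \<in> c" "\<alpha> \<in> iso G G"
proof -
  interpret group G by fact
  obtain \<alpha> where \<alpha>: "\<alpha> \<in> auto G" "c = inner_auts G #>\<^bsub>AutoGroup G\<^esub> \<alpha>"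
    using assms(2) by (auto simp: Out_def FactGroup_def RCOSETS_def AutoGroup_def)
  have "(\<lambda>x\<in>carrier G. x) = (\<lambda>x\<in>carrier G. \<one>\<^bsub>G\<^esub> \<otimes>\<^bsub>G\<^esub> x \<otimes>\<^bsub>G\<^esub> inv\<^bsub>G\<^esub> \<one>\<^bsub>G\<^esub>)"
    by (rule restrict_ext) simp
  then have "(\<lambda>x\<in>carrier G. x) \<in> inner_auts G"
    unfolding inner_auts_def by blast
  moreover have "(\<lambda>x\<in>carrier G. x) \<otimes>\<^bsub>AutoGroup G\<^esub> \<alpha> = \<alpha>"
  proof -
    have "\<alpha> \<in> carrier (BijGroup (carrier G))"
      using \<alpha>(1) by (simp add: BijGroup_def auto_def)
    from monoid.l_one[OF group.is_monoid[OF group_BijGroup] this] show ?thesis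
      unfolding AutoGroup_def by (simp add: BijGroup_def)
  qed
  ultimately have "\<alpha> \<in> c" unfolding \<alpha>(2) r_coset_def by force
  moreover have "\<alpha> \<in> iso G G"
    using \<alpha>(1) by (auto simp: auto_def Bij_def iso_def)
  ultimately show ?thesis by (rule that)
qed

text \<open>Isomorphic quotients satisfy the same sentences, so images under automorphisms stay in
  \<open>A\<close>.\<close>

lemma out_act_models_invariant:
  assumes "sentence \<sigma>" "c \<in> carrier (Out (free_group n))"
  defines "A \<equiv> {N \<in> marked_groups n. models (free_group n Mod N) \<sigma>}"
  shows "out_act c ` A = A"
proof -
  let ?F = "free_group n"
  have F: "group ?F" by (rule group_free_group)
  obtain \<alpha> where \<alpha>: "\<alpha> \<in> c" "\<alpha> \<in> iso ?F ?F"
    using Out_representative[OF F assms(2)] .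
  let ?\<beta> = "inv_into (carrier ?F) \<alpha>"
  have \<beta>: "?\<beta> \<in> iso ?F ?F" by (rule group.iso_set_sym[OF F \<alpha>(2)])
  \<comment> \<open>Stated for every automorphism: \<open>\<alpha>\<close> gives that the action
    maps into \<open>A\<close>, its inverse \<open>?\<beta>\<close> that it maps onto
    \<open>A\<close>.\<close>
  have closed: "\<gamma> ` N \<in> A" if "N \<in> A" "\<gamma> \<in> iso ?F ?F" for \<gamma> N
  proof -
    have N: "N \<lhd> ?F" using that(1) by (simp add: A_def marked_groups_def)
    note * = FactGroup_iso_image[OF F N that(2)]
    have "equiv_for {\<sigma>} (?F Mod \<gamma> ` N) (?F Mod N)"
      using assms(1) * N by (intro iso_imp_equiv_for normal.factorgroup_is_group) auto
    then show ?thesis using that(1) *(1) by (simp add: A_def marked_groups_def equiv_for_def)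
  qed
  have act: "out_act c N = \<alpha> ` N" if "N \<in> A" for N
    using that by (intro out_act_eq[OF F _ assms(2) \<alpha>(1)]) (simp add: A_def marked_groups_def)
  have "N \<in> out_act c ` A" if "N \<in> A" for N
  proof
    have "N \<subseteq> carrier ?F"
      using that by (auto simp: A_def marked_groups_def normal_def dest!: subgroup.subset)
    then have "\<alpha> ` ?\<beta> ` N = N"
      using \<alpha>(2) by (intro image_inv_into_cancel) (auto simp: iso_def bij_betw_def)
    then show "N = out_act c (?\<beta> ` N)" using act[OF closed[OF that \<beta>]] by simp
    show "?\<beta> ` N \<in> A" by (rule closed[OF that \<beta>])
  qed
  then show ?thesis using act closed[OF _ \<alpha>(2)] by auto
qed

section \<open>Countably many sentences\<close>

text \<open>The set consists of those \<open>N\<close> at which each sentence of \<open>F\<close>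
  has its almost sure truth value.\<close>

lemma conull_equiv_for:
  assumes "prob_space \<mu>" "sets \<mu> = sets (marked_groups_borel n)" "out_ergodic n \<mu>"
    and "countable F" "\<forall>\<sigma>\<in>F. sentence \<sigma>"
  shows "\<exists>A\<in>sets \<mu>. measure \<mu> A = 1 \<and>
    (\<forall>N\<in>A. \<forall>M\<in>A. equiv_for F (free_group n Mod N) (free_group n Mod M))"
proof -
  interpret prob_space \<mu> by fact
  have space: "space \<mu> = marked_groups n"
    using sets_eq_imp_space_eq[OF assms(2)] by (simp add: space_marked_groups_borel)
  let ?S = "\<lambda>\<sigma>. {N \<in> space \<mu>. models (free_group n Mod N) \<sigma>}"
  \<comment> \<open>The right side does not depend on \<open>N\<close>: it is the truth value that
    \<open>\<sigma>\<close> takes almost surely, once \<open>prob (?S \<sigma>)\<close> is known to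
    be 0 or 1.\<close>
  let ?T = "\<lambda>\<sigma> N. models (free_group n Mod N) \<sigma> \<longleftrightarrow> prob (?S \<sigma>) = 1"
  have S: "?S \<sigma> \<in> events" if "\<sigma> \<in> F" for \<sigma>
    using sets_models_FactGroup[of \<sigma> n] that assms(2,5) space by simp
  have T: "{N \<in> space \<mu>. ?T \<sigma> N} \<in> events" if "\<sigma> \<in> F" for \<sigma>
    \<comment> \<open>According to that truth value, the set is \<open>?S \<sigma>\<close> or its
      complement.\<close>
    using S[OF that] sets.sets_Collect_neg[OF S[OF that]] by (cases "prob (?S \<sigma>) = 1") simp_all
  have "AE N in \<mu>. ?T \<sigma> N" if "\<sigma> \<in> F" for \<sigma>
  proof -
    have "prob (?S \<sigma>) \<in> {0, 1}"
      using assms(3,5) S[OF that] that out_act_models_invariant[of \<sigma> _ n]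
      unfolding out_ergodic_def space by blast
    then consider "prob (?S \<sigma>) = 1" | "prob (?S \<sigma>) = 0" by blast
    then show ?thesis
    proof cases
      case 1
      then show ?thesis using AE_prob_1[OF 1] by auto
    next
      case 2
      then have "AE N in \<mu>. \<not> models (free_group n Mod N) \<sigma>"
        using S[OF that] prob_eq_0[of "?S \<sigma>"] by (auto elim: AE_mp)
      then show ?thesis using 2 by simp
    qed
  qed
  then have "AE N in \<mu>. \<forall>\<sigma>\<in>F. ?T \<sigma> N"
    using assms(4) by (simp add: AE_ball_countable)
  moreover have A: "{N \<in> space \<mu>. \<forall>\<sigma>\<in>F. ?T \<sigma> N} \<in> events"
    using T assms(4) by (intro sets.sets_Collect_countable_All')
  ultimately have "prob {N \<in> space \<mu>. \<forall>\<sigma>\<in>F. ?T \<sigma> N} = 1"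
    by (simp only: prob_Collect_eq_1[OF A])
  \<comment> \<open>Any two members give each sentence of \<open>F\<close> the same fixed truth
    value, hence agree with each other.\<close>
  then show ?thesis using A by (intro bexI[of _ "{N \<in> space \<mu>. \<forall>\<sigma>\<in>F. ?T \<sigma> N}"])
    (auto simp: equiv_for_def)
qed

section \<open>Countability of the first order formulas\<close>

instance group_term :: countable
  by countable_datatype

text \<open>The type \<open>fm\<close> is uncountable, as \<open>FConj\<close> and
  \<open>FDisj\<close> take sequences. This copy without them is countable and covers all first
  order formulas.\<close>

datatype finitary_fm =
    Eq group_term group_term
  | Neg finitary_fm
  | And finitary_fm finitary_fm
  | Or finitary_fm finitary_fm
  | All nat finitary_fm
  | Ex nat finitary_fm

instance finitary_fm :: countable
  by countable_datatype

primrec fm_of_finitary :: "finitary_fm \<Rightarrow> fm" where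
  "fm_of_finitary (Eq s t) = FEq s t"
| "fm_of_finitary (Neg p) = FNeg (fm_of_finitary p)"
| "fm_of_finitary (And p q) = FAnd (fm_of_finitary p) (fm_of_finitary q)"
| "fm_of_finitary (Or p q) = FOr (fm_of_finitary p) (fm_of_finitary q)"
| "fm_of_finitary (All i p) = FAll i (fm_of_finitary p)"
| "fm_of_finitary (Ex i p) = FEx i (fm_of_finitary p)"

lemma first_order_in_range: "first_order \<phi> \<Longrightarrow> \<phi> \<in> range fm_of_finitary"
  by (induction \<phi>) (auto simp: image_iff intro: fm_of_finitary.simps[symmetric])

lemma countable_first_order: "countable {\<phi>. first_order \<phi>}"
  by (rule countable_subset[of _ "range fm_of_finitary"]) (auto dest: first_order_in_range)

theorem proposition4p1:
  fixes n :: nat and \<mu> :: "fg_word set measure"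
  assumes "prob_space \<mu>"
    and "sets \<mu> = sets (marked_groups_borel n)"
    and "out_invariant n \<mu>"
    and "out_ergodic n \<mu>"
  shows "(\<forall>F. countable F \<and> (\<forall>\<sigma>\<in>F. sentence \<sigma>) \<longrightarrow>
            (\<exists>A\<in>sets \<mu>. measure \<mu> A = 1 \<and>
               (\<forall>N\<in>A. \<forall>M\<in>A. equiv_for F (free_group n Mod N) (free_group n Mod M))))
       \<and> (\<exists>A\<in>sets \<mu>. measure \<mu> A = 1 \<and>
            (\<forall>N\<in>A. \<forall>M\<in>A.
               elementarily_equivalent (free_group n Mod N) (free_group n Mod M)))"
proof -
  \<comment> \<open>This makes elementary equivalence the instance of the first claim in which
    \<open>F\<close> is the set of first order sentences.\<close>
  have "countable {\<sigma>. first_order \<sigma> \<and> sentence \<sigma>}"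
    by (rule countable_subset[OF _ countable_first_order]) blast
  then show ?thesis
    using conull_equiv_for[OF assms(1,2,4)] unfolding elementarily_equivalent_def by blast
qed

end
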